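(* Let $a_1,\dots,a_N$ be nonzero complex numbers with pairwise distinct arguments, and for some $\delta>0$ let $F_1,\dots,F_N$ be analytic in $U_\delta\setminus[0,\infty)$ and algebraically bounded at $\infty$. Suppose $$c_k=\sum_{j=1}^N a_j^{-k}\oint_0^\infty e^{-kp}F_j(p)\,dp\qquad(k\ge1),$$ and that $\sum_{k\ge1} c_kz^k$ has positive, finite radius of convergence. Assume that the entire function $f$ is given by $$f(z)=\sum_{k=1}^\infty\frac{c_kz^k}{k!}.$$ Then $$f(z)=\oint_0^\infty\sum_{j=1}^N\left[\left(e^{\frac{z}{a_j(1+s)}}-1\right)\frac{F_j(\ln(1+s))}{1+s}\right]ds .$$
   Context: Region: for $\delta>0$, $U_\delta=\{z\in\mathbb{C}: |\operatorname{Im} z|\le\delta,\ \operatorname{Re} z\ge-\delta\}$. A function $F$ on $U_\delta\setminus[0,\infty)$ is algebraically bounded at $\infty$ if $|F(p)|\le C|p|^m$ for some $C,m$ and all $p\in U_\delta\setminus[0,\infty)$ with $|p|$ large. Contour: for $0<\epsilon\le\delta$, $\Gamma_\epsilon$ is the contour around $[0,\infty)$ consisting of the ray $\{x-i\epsilon:x\in[0,\infty)\}$ oriented towards the left, followed by the left semicircle of radius $\epsilon$ centered at the origin, from $-i\epsilon$ to $i\epsilon$, oriented clockwise, followed by the ray $\{x+i\epsilon:x\in[0,\infty)\}$ oriented towards the right. If $g$ is analytic in $U_\delta\setminus[0,\infty)$ for some $\delta>0$ and $g(s)\to0$ uniformly in $U_\delta$ as $\operatorname{Re}s\to\infty$,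 then $\oint_0^\infty g(s)\,ds$ denotes $\int_{\Gamma_\epsilon}g(s)\,ds$, which is independent of $\epsilon$ for $\epsilon$ small enough. $\ln(1+s)$ is the principal branch, with cut $(-\infty,-1]$. *)

theory Defs
  imports "HOL-Complex_Analysis.Complex_Analysis"
begin

definition U :: "real \<Rightarrow> complex set" where
  "U \<delta> = {z. \<bar>Im z\<bar> \<le> \<delta> \<and> Re z \<ge> -\<delta>}"

definition algebraically_bounded :: "real \<Rightarrow> (complex \<Rightarrow> complex) \<Rightarrow> bool" where
  "algebraically_bounded \<delta> F \<longleftrightarrow>
     (\<exists>C m R :: real. \<forall>p \<in> U \<delta> - \<real>\<^sub>\<ge>\<^sub>0. norm p \<ge> R \<longrightarrow> norm (F p) \<le> C * norm p powr m)"

text \<open>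
  The contour \<open>\<Gamma>\<^sub>\<epsilon>\<close> is unbounded, so it is not a path in the sense of the library and is split
  into its three pieces. The gauge integrals over \<open>{0..}\<close> cover improper integrals. The lower ray
  is traversed towards the left, hence the minus sign; the angle on the semicircle decreases from
  \<open>3\<pi>/2\<close> to \<open>\<pi>/2\<close>, that is, clockwise through \<open>-\<epsilon>\<close>.
\<close>

definition has_Gamma_integral :: "(complex \<Rightarrow> complex) \<Rightarrow> real \<Rightarrow> complex \<Rightarrow> bool" where
  "has_Gamma_integral g \<epsilon> I \<longleftrightarrow>
     (\<exists>A B C. ((\<lambda>x::real. g (of_real x - \<i> * of_real \<epsilon>)) has_integral A) {0..} \<and>
              (g has_contour_integral B) (part_circlepath 0 \<epsilon> (3 * pi / 2) (pi / 2)) \<and>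
              ((\<lambda>x::real. g (of_real x + \<i> * of_real \<epsilon>)) has_integral C) {0..} \<and>
              I = - A + B + C)"

definition vanishes_at_infinity :: "real \<Rightarrow> (complex \<Rightarrow> complex) \<Rightarrow> bool" where
  "vanishes_at_infinity \<delta> g \<longleftrightarrow>
     (\<forall>e>0. \<exists>R. \<forall>s \<in> U \<delta> - \<real>\<^sub>\<ge>\<^sub>0. Re s \<ge> R \<longrightarrow> norm (g s) < e)"

text \<open>
  \<open>has_oint g I\<close> says that the integral of \<open>g\<close> around \<open>[0,\<infinity>)\<close> is meaningful and has the value
  \<open>I\<close>: the integral over \<open>\<Gamma>\<^sub>\<epsilon>\<close> converges to the same \<open>I\<close> for all sufficiently small \<open>\<epsilon> > 0\<close>.
\<close>

definition has_oint :: "(complex \<Rightarrow> complex) \<Rightarrow> complex \<Rightarrow> bool" (infixr "has'_oint" 46) where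
  "(g has_oint I) \<longleftrightarrow>
     (\<exists>\<delta>>0. g analytic_on (U \<delta> - \<real>\<^sub>\<ge>\<^sub>0) \<and> vanishes_at_infinity \<delta> g) \<and>
     (\<forall>\<^sub>F \<epsilon> in at_right 0. has_Gamma_integral g \<epsilon> I)"

definition oint :: "(complex \<Rightarrow> complex) \<Rightarrow> complex" where
  "oint g = (THE I. g has_oint I)"

lemma has_Gamma_integral_unique:
  assumes "has_Gamma_integral g \<epsilon> I" "has_Gamma_integral g \<epsilon> J"
  shows "I = J"
  using assms unfolding has_Gamma_integral_def
  by (metis has_integral_unique has_contour_integral_unique)

lemma has_oint_unique:
  assumes "g has_oint I" "g has_oint J"
  shows "I = J"
proof -
  have "\<forall>\<^sub>F \<epsilon> in at_right 0. has_Gamma_integral g \<epsilon> I \<and> has_Gamma_integral g \<epsilon> J"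
    using assms unfolding has_oint_def by (auto intro: eventually_conj)
  then have "\<exists>\<epsilon>. has_Gamma_integral g \<epsilon> I \<and> has_Gamma_integral g \<epsilon> J"
    by (intro eventually_happens') auto
  then show ?thesis
    by (blast intro: has_Gamma_integral_unique)
qed

lemma oint_eqI: "g has_oint I \<Longrightarrow> oint g = I"
  unfolding oint_def by (blast intro: has_oint_unique)

end

(* The domain \<open>slit_strip \<delta>\<close> is starlike about \<open>- \<delta> / 2\<close>, so an analytic integrand \<open>G\<close> that decays
   exponentially has a primitive \<open>P\<close> there, with limits \<open>L1\<close> above and \<open>L2\<close> below the cut as
   \<open>Re p \<rightarrow> \<infinity>\<close>, and its integral over every \<open>\<Gamma>\<^sub>\<epsilon>\<close> is \<open>L1 - L2\<close>. The substitution \<open>p = Ln (1 + s)\<close> turns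
   the integrand of the theorem into \<open>(exp (z e\<^sup>-\<^sup>p / a\<^sub>j) - 1) F\<^sub>j(p)\<close>; expanding the exponential and
   integrating termwise over a fixed contour in the \<open>p\<close>-plane gives the coefficients \<open>c\<^sub>k z\<^sup>k / k!\<close>. *)
theory Submission
  imports Defs "HOL-Real_Asymp.Real_Asymp"
begin

section \<open>The slit domain\<close>

text \<open>Strict inequalities make this an open set, as complex differentiability and primitives
  require. It lies in \<open>U \<delta>\<close> off the cut and contains the closed region
  \<open>U \<eta>\<close> off the cut for each \<eta> < \<delta>.\<close>

definition slit_strip :: "real \<Rightarrow> complex set" where
  "slit_strip \<delta> = {p. \<bar>Im p\<bar> < \<delta> \<and> - \<delta> < Re p} - \<real>\<^sub>\<ge>\<^sub>0"

lemma slit_strip_subset_U: "slit_strip \<delta> \<subseteq> U \<delta> - \<real>\<^sub>\<ge>\<^sub>0"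
  by (auto simp: slit_strip_def U_def)

lemma open_slit_strip: "open (slit_strip \<delta>)"
proof -
  have "{p. \<bar>Im p\<bar> < \<delta> \<and> - \<delta> < Re p} = {p. \<bar>Im p\<bar> < \<delta>} \<inter> {p. - \<delta> < Re p}"
    by auto
  moreover have "open {p. \<bar>Im p\<bar> < \<delta>}" "open {p. - \<delta> < Re p}"
    by (intro open_Collect_less continuous_intros)+
  ultimately show ?thesis
    unfolding slit_strip_def by (auto intro!: open_Diff closed_nonneg_Reals_complex)
qed

text \<open>The center is a negative real number. A segment from it to a non-real point meets the
  real axis only at the center, and a real point of the domain is itself negative, so no such
  segment touches the cut.\<close>

lemma starlike_slit_strip:
  assumes "0 < \<delta>"
  shows "starlike (slit_strip \<delta>)"
  unfolding starlike_def
proof (intro bexI ballI subsetI)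
  let ?b = "- complex_of_real (\<delta> / 2)"
  show "?b \<in> slit_strip \<delta>"
    using assms by (auto simp: slit_strip_def complex_nonneg_Reals_iff)
  fix p q assume p: "p \<in> slit_strip \<delta>" and q: "q \<in> closed_segment ?b p"
  obtain u where u: "0 \<le> u" "u \<le> 1" "q = (1 - u) *\<^sub>R ?b + u *\<^sub>R p"
    using q by (auto simp: in_segment)
  have re: "Re q = - ((1 - u) * (\<delta> / 2)) + u * Re p" and im: "Im q = u * Im p"
    by (simp_all add: u field_simps)
  have "\<bar>Im q\<bar> < \<delta>"
  proof -
    have "u * \<bar>Im p\<bar> \<le> 1 * \<bar>Im p\<bar>"
      using u by (intro mult_right_mono) auto
    then show ?thesis
      using p u by (auto simp: im abs_mult slit_strip_def)
  qed
  moreover have "- \<delta> < Re q"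
  proof -
    have "convex {w. Re w > - \<delta>}"
      by (rule convex_halfspace_Re_gt)
    then have "closed_segment ?b p \<subseteq> {w. Re w > - \<delta>}"
      using p assms by (intro closed_segment_subset) (auto simp: slit_strip_def)
    then show ?thesis using q by auto
  qed
  moreover have "q \<notin> \<real>\<^sub>\<ge>\<^sub>0"
  proof
    assume "q \<in> \<real>\<^sub>\<ge>\<^sub>0"
    then have *: "Im q = 0" "Re q \<ge> 0" by (auto simp: complex_nonneg_Reals_iff)
    have u0: "u \<noteq> 0"
      using * assms by (auto simp: re)
    then have "Im p = 0" using * im by auto
    then have "Re p < 0"
      using p by (auto simp: slit_strip_def complex_nonneg_Reals_iff)
    then have "u * Re p < 0" using u0 u by (simp add: mult_pos_neg)
    moreover have "(1 - u) * (\<delta> / 2) \<ge> 0" using u assms by auto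
    ultimately show False using * re by linarith
  qed
  ultimately show "q \<in> slit_strip \<delta>"
    by (simp add: slit_strip_def)
qed

section \<open>Integrability and primitives along a ray\<close>

text \<open>One criterion serves both planes: the exponent -3/2 is the decay that
  \<open>exp (- Re p / 2)\<close> acquires under \<open>p = Ln (1 + s)\<close> together with the
  factor \<open>1 / (1 + s)\<close>, and exponential decay in the p-plane is stronger still.\<close>

lemma absolutely_integrable_on_ray:
  fixes h :: "real \<Rightarrow> complex"
  assumes h: "continuous_on {0..} h" and K: "\<And>x. R \<le> x \<Longrightarrow> norm (h x) \<le> K * x powr (-3/2)"
  shows "h absolutely_integrable_on {0..}"
proof -
  \<comment> \<open>The lower bound 1 keeps the majorant away from the singularity of the power at
    0.\<close>
  define r where "r = max R 1"
  have "h absolutely_integrable_on {0..r}"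
    by (intro absolutely_integrable_continuous_real continuous_on_subset[OF h]) auto
  moreover have "h absolutely_integrable_on {r..}"
  proof (rule measurable_bounded_by_integrable_imp_absolutely_integrable)
    show "h \<in> borel_measurable (lebesgue_on {r..})"
      by (intro continuous_imp_measurable_on_sets_lebesgue continuous_on_subset[OF h])
        (auto simp: r_def)
    show "(\<lambda>x. K * x powr (-3/2)) integrable_on {r..}"
      using has_integral_integrable[OF has_integral_mult_right[OF has_integral_powr_to_inf[of "-3/2" r]]]
      by (auto simp: r_def)
  qed (use K in \<open>auto simp: r_def\<close>)
  ultimately have "h absolutely_integrable_on ({0..r} \<union> {r..})"
    by (rule absolutely_integrable_Un)
  moreover have "{0..r} \<union> {r..} = {0..}"
    by (auto simp: r_def)
  ultimately show ?thesis by simp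
qed

text \<open>The fundamental theorem of calculus expresses \<open>P b - P 0\<close> as an integral
  over \<open>{0..b}\<close>, and absolute integrability makes these integrals converge. This yields
  both the existence of limits of a primitive and the values of ray integrals.\<close>

lemma primitive_tendsto_on_ray:
  fixes h P :: "real \<Rightarrow> complex"
  assumes h: "h absolutely_integrable_on {0..}"
    and P: "\<And>x. 0 \<le> x \<Longrightarrow> (P has_vector_derivative h x) (at x within {0..})"
  shows "(P \<longlongrightarrow> P 0 + integral {0..} h) at_top"
proof -
  have "((\<lambda>b. LINT x:{0..b}|lebesgue. h x) \<longlongrightarrow> (LINT x:{0..}|lebesgue. h x)) at_top"
    by (intro tendsto_set_lebesgue_integral_at_top h) auto
  then have "((\<lambda>b. P 0 + (LINT x:{0..b}|lebesgue. h x)) \<longlongrightarrow> P 0 + integral {0..} h) at_top"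
    using h by (intro tendsto_intros) (simp add: set_lebesgue_integral_eq_integral(2))
  moreover have "\<forall>\<^sub>F b in at_top. P 0 + (LINT x:{0..b}|lebesgue. h x) = P b"
    using eventually_ge_at_top[of 0]
  proof eventually_elim
    case (elim b)
    have "(h has_integral P b - P 0) {0..b}"
      using elim by (intro fundamental_theorem_of_calculus has_vector_derivative_within_subset[OF P]) auto
    moreover have "h absolutely_integrable_on {0..b}"
      by (rule set_integrable_subset[OF h]) auto
    ultimately show ?case
      by (simp add: set_lebesgue_integral_eq_integral(2) integral_unique)
  qed
  ultimately show ?thesis
    by (rule Lim_transform_eventually)
qed

section \<open>The contour and its integral by means of a primitive\<close>

lemma horizontal_ray_in_slit_strip:
  assumes "0 < \<bar>y\<bar>" "\<bar>y\<bar> < \<delta>" "0 \<le> x"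
  shows "of_real x + \<i> * of_real y \<in> slit_strip \<delta>"
  using assms by (auto simp: slit_strip_def complex_nonneg_Reals_iff)

lemma semicircle_in_slit_strip:
  assumes "0 < \<epsilon>" "\<epsilon> < \<delta>"
  shows "path_image (part_circlepath 0 \<epsilon> (3 * pi / 2) (pi / 2)) \<subseteq> slit_strip \<delta>"
proof
  fix w assume "w \<in> path_image (part_circlepath 0 \<epsilon> (3 * pi / 2) (pi / 2))"
  then obtain t where t: "pi / 2 \<le> t" "t \<le> 3 * pi / 2" "w = \<epsilon> * cis t"
    by (auto simp: path_image_part_circlepath' closed_segment_eq_real_ivl split: if_splits)
  \<comment> \<open>Subtracting pi moves the angles into the interval from -pi/2 to pi/2, where the
    cosine is nonnegative; hence \<open>cos t\<close> is at most 0.\<close>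
  have "cos (t - pi) \<ge> 0"
    using t by (intro cos_ge_zero) auto
  then have "\<epsilon> * cos t \<le> 0"
    using assms by (simp add: cos_diff mult_le_0_iff)
  moreover have "norm w = \<epsilon>"
    using t assms by (simp add: norm_mult)
  ultimately have *: "Re w \<le> 0" "norm w = \<epsilon>"
    using t by auto
  \<comment> \<open>A point of the cut with nonpositive real part would be 0, contrary to its norm
    being \<epsilon>.\<close>
  have "w \<notin> \<real>\<^sub>\<ge>\<^sub>0"
    using * assms by (auto simp: complex_nonneg_Reals_iff cmod_def)
  then show "w \<in> slit_strip \<delta>"
    using * assms abs_Im_le_cmod[of w] abs_Re_le_cmod[of w] by (auto simp: slit_strip_def)
qed

lemma has_vector_derivative_on_horizontal_ray:
  assumes "(P has_field_derivative G) (at (of_real x + \<i> * of_real y))"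
  shows "((\<lambda>t. P (of_real t + \<i> * of_real y)) has_vector_derivative G) (at x within A)"
proof -
  have "((\<lambda>t::real. of_real t + \<i> * of_real y) has_vector_derivative 1) (at x within A)"
    by (auto intro!: derivative_eq_intros has_vector_derivative_of_real simp: has_vector_derivative_def scaleR_conv_of_real)
  from field_vector_diff_chain_within[OF this has_field_derivative_at_within[OF assms]]
  show ?thesis by (simp add: o_def)
qed

text \<open>The three pieces telescope: the reversed lower ray gives
  \<open>P (-i \<epsilon>) - L2\<close>, the semicircle
  \<open>P (i \<epsilon>) - P (-i \<epsilon>)\<close> and the upper ray
  \<open>L1 - P (i \<epsilon>)\<close>. The endpoint values cancel, which is where independence of
  \<epsilon> will come from.\<close>

lemma has_Gamma_integral_primitive:
  assumes \<epsilon>: "0 < \<epsilon>" "\<epsilon> < \<delta>"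
    and P: "\<And>p. p \<in> slit_strip \<delta> \<Longrightarrow> (P has_field_derivative G p) (at p)"
    and abs: "\<And>y. \<bar>y\<bar> = \<epsilon> \<Longrightarrow> (\<lambda>x. G (of_real x + \<i> * of_real y)) absolutely_integrable_on {0..}"
    and upper: "((\<lambda>x. P (of_real x + \<i> * of_real \<epsilon>)) \<longlongrightarrow> L1) at_top"
    and lower: "((\<lambda>x. P (of_real x - \<i> * of_real \<epsilon>)) \<longlongrightarrow> L2) at_top"
  shows "has_Gamma_integral G \<epsilon> (L1 - L2)"
proof -
  have ray: "((\<lambda>x. G (of_real x + \<i> * of_real y)) has_integral (L - P (\<i> * of_real y))) {0..}"
    if y: "\<bar>y\<bar> = \<epsilon>" and L: "((\<lambda>x. P (of_real x + \<i> * of_real y)) \<longlongrightarrow> L) at_top" for y L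
  proof -
    have "((\<lambda>x. P (of_real x + \<i> * of_real y)) \<longlongrightarrow> P (of_real 0 + \<i> * of_real y) +
            integral {0..} (\<lambda>x. G (of_real x + \<i> * of_real y))) at_top"
      using y \<epsilon> by (intro primitive_tendsto_on_ray abs has_vector_derivative_on_horizontal_ray P
          horizontal_ray_in_slit_strip) auto
    then have "L = P (\<i> * of_real y) + integral {0..} (\<lambda>x. G (of_real x + \<i> * of_real y))"
      using tendsto_unique[OF trivial_limit_at_top_linorder L] by fastforce
    moreover have "(\<lambda>x. G (of_real x + \<i> * of_real y)) integrable_on {0..}"
      using abs[OF y] by (rule set_lebesgue_integral_eq_integral(1))
    ultimately show ?thesis
      by (simp add: has_integral_integral)
  qed
  have "(G has_contour_integral (P (pathfinish (part_circlepath 0 \<epsilon> (3 * pi / 2) (pi / 2))) -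
      P (pathstart (part_circlepath 0 \<epsilon> (3 * pi / 2) (pi / 2))))) (part_circlepath 0 \<epsilon> (3 * pi / 2) (pi / 2))"
    using semicircle_in_slit_strip[OF \<epsilon>]
    by (intro contour_integral_primitive[of "slit_strip \<delta>"])
      (auto intro: has_field_derivative_at_within P)
  moreover have "exp (\<i> * of_real (3 * pi / 2)) = - \<i>" "exp (\<i> * of_real (pi / 2)) = \<i>"
    using cos_3over2_pi sin_3over2_pi by (simp_all only: cis_conv_exp[symmetric]) (simp_all add: complex_eq_iff)
  ultimately have circ: "(G has_contour_integral (P (\<i> * of_real \<epsilon>) - P (- \<i> * of_real \<epsilon>)))
      (part_circlepath 0 \<epsilon> (3 * pi / 2) (pi / 2))"
    by (simp only: pathstart_part_circlepath pathfinish_part_circlepath) (simp add: mult.commute)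
  show ?thesis
    unfolding has_Gamma_integral_def
    using ray[of \<epsilon> L1] ray[of "- \<epsilon>" L2] upper lower circ \<epsilon>
    by (intro exI conjI) auto
qed

section \<open>Exponential decay and limits of primitives at infinity\<close>

text \<open>The rate 1/2 is what remains of a factor of size \<open>exp (- Re p)\<close> after
  algebraic growth has been absorbed into \<open>exp (Re p / 2)\<close>.\<close>

definition exp_decaying :: "real \<Rightarrow> (complex \<Rightarrow> complex) \<Rightarrow> bool" where
  "exp_decaying \<delta> G \<longleftrightarrow>
     (\<exists>K R. 0 \<le> K \<and> (\<forall>p \<in> slit_strip \<delta>. R \<le> Re p \<longrightarrow> norm (G p) \<le> K * exp (- Re p / 2)))"

lemma continuous_on_horizontal_ray:
  assumes "G holomorphic_on slit_strip \<delta>" "0 < \<bar>y\<bar>" "\<bar>y\<bar> < \<delta>"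
  shows "continuous_on {0..} (\<lambda>x. G (of_real x + \<i> * of_real y))"
  by (rule continuous_on_compose2[OF holomorphic_on_imp_continuous_on[OF assms(1)]])
    (use horizontal_ray_in_slit_strip[OF assms(2,3)] in \<open>auto intro!: continuous_intros\<close>)

lemma exp_decaying_imp_absolutely_integrable:
  assumes G: "G holomorphic_on slit_strip \<delta>" "exp_decaying \<delta> G" and y: "0 < \<bar>y\<bar>" "\<bar>y\<bar> < \<delta>"
  shows "(\<lambda>x. G (of_real x + \<i> * of_real y)) absolutely_integrable_on {0..}"
proof -
  obtain K R where K: "0 \<le> K"
    "\<And>p. p \<in> slit_strip \<delta> \<Longrightarrow> R \<le> Re p \<Longrightarrow> norm (G p) \<le> K * exp (- Re p / 2)"
    using G(2) by (auto simp: exp_decaying_def)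
  have "\<forall>\<^sub>F x::real in at_top. exp (- x / 2) \<le> x powr (-3/2)"
    by real_asymp
  then obtain R' where R': "\<And>x::real. R' \<le> x \<Longrightarrow> exp (- x / 2) \<le> x powr (-3/2)"
    by (auto simp: eventually_at_top_linorder)
  show ?thesis
  proof (rule absolutely_integrable_on_ray[OF continuous_on_horizontal_ray[OF G(1) y]])
    fix x assume x: "max 0 (max R R') \<le> x"
    have "norm (G (of_real x + \<i> * of_real y)) \<le> K * exp (- x / 2)"
      using K(2)[OF horizontal_ray_in_slit_strip[OF y, of x]] x by simp
    also have "\<dots> \<le> K * x powr (-3/2)"
      using R'[of x] x K(1) by (intro mult_left_mono) auto
    finally show "norm (G (of_real x + \<i> * of_real y)) \<le> K * x powr (-3/2)" .
  qed
qed

text \<open>The limit exists along one ray by integrability. Any other point on the same side of the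
  cut is joined to that ray by a vertical segment of length at most 2\<delta>, along which the
  derivative is exponentially small. The condition \<open>0 < Im p * y\<close> encodes lying on the
  side of \<open>y\<close>. Uniformity is needed because \<open>Ln (1 + s)\<close> does not map
  horizontal rays to horizontal rays.\<close>

lemma primitive_limit_half_strip:
  assumes G: "G holomorphic_on slit_strip \<delta>" "exp_decaying \<delta> G" and y: "0 < \<bar>y\<bar>" "\<bar>y\<bar> < \<delta>"
    and P: "\<And>p. p \<in> slit_strip \<delta> \<Longrightarrow> (P has_field_derivative G p) (at p)"
  obtains L where "\<And>e. 0 < e \<Longrightarrow> \<exists>R. \<forall>p \<in> slit_strip \<delta>. R \<le> Re p \<and> 0 < Im p * y \<longrightarrow> norm (P p - L) < e"
proof -
  obtain K R where K: "0 \<le> K"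
    "\<And>p. p \<in> slit_strip \<delta> \<Longrightarrow> R \<le> Re p \<Longrightarrow> norm (G p) \<le> K * exp (- Re p / 2)"
    using G(2) by (auto simp: exp_decaying_def)
  obtain L where L: "((\<lambda>x. P (of_real x + \<i> * of_real y)) \<longlongrightarrow> L) at_top"
    using primitive_tendsto_on_ray[OF exp_decaying_imp_absolutely_integrable[OF G y],
        of "\<lambda>x. P (of_real x + \<i> * of_real y)"]
      has_vector_derivative_on_horizontal_ray[OF P[OF horizontal_ray_in_slit_strip[OF y]]]
    by blast
  have "\<exists>R. \<forall>p \<in> slit_strip \<delta>. R \<le> Re p \<and> 0 < Im p * y \<longrightarrow> norm (P p - L) < e" if e: "0 < e" for e
  proof -
    have "\<forall>\<^sub>F x in at_top. dist (P (of_real x + \<i> * of_real y)) L < e / 2"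
      using L e by (intro tendstoD) auto
    then obtain R1 where R1: "\<And>x. R1 \<le> x \<Longrightarrow> dist (P (of_real x + \<i> * of_real y)) L < e / 2"
      by (auto simp: eventually_at_top_linorder)
    have "((\<lambda>x::real. K * exp (- x / 2) * (2 * \<delta>)) \<longlongrightarrow> 0) at_top"
      by real_asymp
    then have "\<forall>\<^sub>F x in at_top. K * exp (- x / 2) * (2 * \<delta>) < e / 2"
      using e by (intro order_tendstoD) auto
    then obtain R2 where R2: "\<And>x. R2 \<le> x \<Longrightarrow> K * exp (- x / 2) * (2 * \<delta>) < e / 2"
      by (auto simp: eventually_at_top_linorder)
    have "norm (P p - L) < e"
      if p: "p \<in> slit_strip \<delta>" and Re: "max 0 (max R (max R1 R2)) \<le> Re p" and Im: "0 < Im p * y" for p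
    proof -
      define q where "q = of_real (Re p) + \<i> * of_real y"
      \<comment> \<open>This vertical segment contains \<open>p\<close> and the point
        \<open>q\<close> of the reference ray, and avoids the cut. It is convex, so the mean value
        inequality applies to it, unlike to the slit domain as a whole.\<close>
      define S where "S = {w. Re w = Re p \<and> \<bar>Im w\<bar> < \<delta> \<and> 0 < Im w * y}"
      have "S = {w. Re w \<ge> Re p} \<inter> {w. Re w \<le> Re p} \<inter> {w. - \<delta> < Im w} \<inter> {w. Im w < \<delta>} \<inter>
          (if 0 < y then {w. Im w > 0} else {w. Im w < 0})"
        using y by (auto simp: S_def zero_less_mult_iff)
      then have "convex S"
        by (auto intro!: convex_Int convex_halfspace_Re_ge convex_halfspace_Re_le
            convex_halfspace_Im_gt convex_halfspace_Im_lt)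
      moreover have S: "S \<subseteq> slit_strip \<delta>"
        using Re y by (auto simp: S_def slit_strip_def complex_nonneg_Reals_iff)
      ultimately have "norm (P p - P q) \<le> (K * exp (- Re p / 2)) * norm (p - q)"
      proof (intro field_differentiable_bound[of S])
        show "p \<in> S" "q \<in> S"
          using p Im y by (auto simp: S_def q_def slit_strip_def zero_less_mult_iff)
        show "norm (G w) \<le> K * exp (- Re p / 2)" if "w \<in> S" for w
          using K(2)[of w] S that Re by (auto simp: S_def)
      qed (use S P in \<open>auto intro: has_field_derivative_at_within\<close>)
      also have "\<dots> \<le> K * exp (- Re p / 2) * (2 * \<delta>)"
      proof (intro mult_left_mono)
        have "p - q = \<i> * of_real (Im p - y)"
          by (simp add: q_def complex_eq_iff)
        then have "norm (p - q) = \<bar>Im p - y\<bar>"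
          by (simp add: norm_mult flip: of_real_diff)
        also have "\<dots> \<le> 2 * \<delta>"
          using p y by (auto simp: slit_strip_def)
        finally show "norm (p - q) \<le> 2 * \<delta>" .
      qed (use K in auto)
      also have "\<dots> < e / 2"
        using R2 Re by auto
      finally have "norm (P p - P q) < e / 2" .
      moreover have "norm (P q - L) < e / 2"
        using R1[of "Re p"] Re by (simp add: q_def dist_norm)
      ultimately show ?thesis
        using norm_triangle_lt[of "P p - P q" "P q - L" e] by simp
    qed
    then show ?thesis by blast
  qed
  then show ?thesis using that by blast
qed

section \<open>The substitution \<open>p = Ln (1 + s)\<close>\<close>

text \<open>Since \<open>Re (1 + s)\<close> is at least 1/2, the argument of \<open>1 + s\<close> is
  at most 2\<eta> in absolute value, by the bound on arctan; this explains the condition 2\<eta> <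
  \<delta>. The cut is preserved in reverse as well: if the logarithm is a real x \<ge> 0, then s =
  exp x - 1 \<ge> 0.\<close>

lemma
  assumes s: "s \<in> U \<eta> - \<real>\<^sub>\<ge>\<^sub>0" and \<eta>: "\<eta> \<le> 1/2" "2 * \<eta> < \<delta>"
  shows Re_one_plus_ge_half: "1/2 \<le> Re (1 + s)"
    and Ln_one_plus_in_slit_strip: "Ln (1 + s) \<in> slit_strip \<delta>"
proof -
  have \<eta>0: "0 \<le> \<eta>" and Im: "\<bar>Im s\<bar> \<le> \<eta>" and Re: "- \<eta> \<le> Re s"
    using s by (auto simp: U_def)
  show ge: "1/2 \<le> Re (1 + s)" using Re \<eta> by simp
  then have nz: "1 + s \<noteq> 0" by (metis zero_complex.simps(1) half_gt_zero_iff not_le zero_less_one)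
  have "\<bar>Im (Ln (1 + s))\<bar> = \<bar>arctan (Im s / Re (1 + s))\<bar>"
    using ge Im_Ln_eq[OF nz] by simp
  also have "\<dots> \<le> \<bar>Im s / Re (1 + s)\<bar>"
    by (rule abs_arctan_le)
  also have "\<dots> \<le> \<eta> / (1/2)"
    unfolding abs_divide using ge Im by (intro frac_le) auto
  finally have "\<bar>Im (Ln (1 + s))\<bar> < \<delta>" using \<eta> by simp
  moreover have "- \<delta> < Re (Ln (1 + s))"
  proof -
    \<comment> \<open>The norm of \<open>1 + s\<close> is at least 1 - \<eta>, and \<eta> \<le> 1/2
      later weakens this lower bound to -2\<eta>.\<close>
    have "- \<eta> - 2 * \<eta>\<^sup>2 \<le> ln (1 - \<eta>)"
      using \<eta> \<eta>0 by (intro ln_one_minus_pos_lower_bound) auto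
    also have "\<dots> \<le> ln (norm (1 + s))"
      using \<eta> Re complex_Re_le_cmod[of "1 + s"] by (intro ln_mono) auto
    finally have "- \<eta> - 2 * \<eta>\<^sup>2 \<le> Re (Ln (1 + s))"
      using nz by simp
    moreover have "\<eta> * \<eta> \<le> \<eta> * (1/2)"
      using \<eta> \<eta>0 by (intro mult_left_mono) auto
    ultimately show ?thesis using \<eta> by (simp add: power2_eq_square)
  qed
  moreover have "Ln (1 + s) \<notin> \<real>\<^sub>\<ge>\<^sub>0"
  proof
    assume "Ln (1 + s) \<in> \<real>\<^sub>\<ge>\<^sub>0"
    then obtain x where x: "Ln (1 + s) = of_real x" "0 \<le> x"
      by (auto simp: nonneg_Reals_def)
    then have "1 + s = of_real (exp x)"
      by (metis exp_Ln exp_of_real nz)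
    then have "s = of_real (exp x - 1)"
      by (simp add: algebra_simps)
    then have "s \<in> \<real>\<^sub>\<ge>\<^sub>0"
      using x by (simp only: nonneg_Reals_of_real_iff) simp
    then show False using s by simp
  qed
  ultimately show "Ln (1 + s) \<in> slit_strip \<delta>"
    by (simp add: slit_strip_def)
qed

text \<open>With n the norm of \<open>1 + s\<close>, the logarithm has real part
  \<open>ln n\<close>, so the decay hypothesis gives the power -1/2 of n and the division by
  \<open>1 + s\<close> contributes another -1. The threshold \<open>exp R\<close> ensures that
  \<open>ln n\<close> is at least \<open>R\<close>.\<close>

lemma norm_comp_Ln_le:
  assumes K: "0 \<le> K" "\<And>p. p \<in> slit_strip \<delta> \<Longrightarrow> R \<le> Re p \<Longrightarrow> norm (G p) \<le> K * exp (- Re p / 2)"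
    and s: "s \<in> U \<eta> - \<real>\<^sub>\<ge>\<^sub>0" "exp R \<le> Re s" and \<eta>: "\<eta> \<le> 1/2" "2 * \<eta> < \<delta>"
  shows "norm (G (Ln (1 + s)) / (1 + s)) \<le> K * Re s powr (-3/2)"
proof -
  define n where "n = norm (1 + s)"
  have Re: "0 < Re s"
    using s(2) exp_gt_zero[of R] by linarith
  have n: "Re s \<le> n" "0 < n"
    using Re complex_Re_le_cmod[of "1 + s"] by (auto simp: n_def)
  then have nz: "1 + s \<noteq> 0" by (auto simp: n_def)
  have ReLn: "Re (Ln (1 + s)) = ln n"
    using nz by (simp add: n_def)
  have "ln (exp R) \<le> ln n"
    using n s(2) Re by (intro ln_mono) auto
  then have "norm (G (Ln (1 + s))) \<le> K * exp (- ln n / 2)"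
    using K(2)[OF Ln_one_plus_in_slit_strip[OF s(1) \<eta>]] ReLn by simp
  then have "norm (G (Ln (1 + s)) / (1 + s)) \<le> K * (exp (- ln n / 2) / n)"
    using n by (simp add: norm_divide n_def divide_right_mono)
  also have "exp (- ln n / 2) / n = n powr (-3/2)"
  proof -
    have "exp (- ln n / 2) / n = exp (- ln n / 2 - ln n)"
      by (subst exp_diff) (use n in simp)
    then show ?thesis using n by (simp add: powr_def)
  qed
  also have "K * n powr (-3/2) \<le> K * Re s powr (-3/2)"
    using n Re K by (intro mult_left_mono powr_mono2') auto
  finally show ?thesis .
qed

lemma holomorphic_on_comp_Ln:
  assumes G: "G holomorphic_on slit_strip \<delta>" and \<eta>: "\<eta> \<le> 1/2" "2 * \<eta> < \<delta>"
  shows "(\<lambda>s. G (Ln (1 + s)) / (1 + s)) holomorphic_on slit_strip \<eta>"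
proof -
  have pos: "0 < Re (1 + s)" if "s \<in> slit_strip \<eta>" for s
    using Re_one_plus_ge_half[OF subsetD[OF slit_strip_subset_U that] \<eta>] by linarith
  have "(\<lambda>s. Ln (1 + s)) holomorphic_on slit_strip \<eta>"
    using pos by (intro holomorphic_intros) (force simp: complex_nonpos_Reals_iff)
  then have "(G \<circ> (\<lambda>s. Ln (1 + s))) holomorphic_on slit_strip \<eta>"
    using Ln_one_plus_in_slit_strip[OF _ \<eta>] slit_strip_subset_U
    by (intro holomorphic_on_compose_gen[OF _ G]) auto
  moreover have "1 + s \<noteq> 0" if "s \<in> slit_strip \<eta>" for s
    using pos[OF that] by force
  ultimately show ?thesis
    by (intro holomorphic_on_divide holomorphic_intros) (auto simp: o_def)
qed

text \<open>
  Both integrals equal the difference of the limits at infinity, above and below the cut, of a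
  primitive \<open>P\<close> of \<open>G\<close>, because \<open>P (Ln (1 + s))\<close> is a primitive of \<open>G (Ln (1 + s)) / (1 + s)\<close>;
  no contour has to be deformed.
\<close>
lemma Gamma_integral_exists:
  assumes \<delta>: "0 < \<delta>" and G: "G holomorphic_on slit_strip \<delta>" "exp_decaying \<delta> G"
  obtains I where "\<And>\<epsilon>. 0 < \<epsilon> \<Longrightarrow> \<epsilon> < \<delta> \<Longrightarrow> has_Gamma_integral G \<epsilon> I"
    and "\<And>\<epsilon>. 0 < \<epsilon> \<Longrightarrow> \<epsilon> < 1/2 \<Longrightarrow> 2 * \<epsilon> < \<delta> \<Longrightarrow>
           has_Gamma_integral (\<lambda>s. G (Ln (1 + s)) / (1 + s)) \<epsilon> I"
proof -
  obtain P where P: "\<And>p. p \<in> slit_strip \<delta> \<Longrightarrow> (P has_field_derivative G p) (at p)"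
    using holomorphic_starlike_primitive[of "slit_strip \<delta>" G "{}"] G(1) open_slit_strip[of \<delta>]
      starlike_slit_strip[OF \<delta>] holomorphic_on_imp_continuous_on
    by (metis Diff_empty finite.emptyI holomorphic_on_imp_differentiable_at)
  obtain L1 where L1: "\<And>e. 0 < e \<Longrightarrow>
      \<exists>R. \<forall>p \<in> slit_strip \<delta>. R \<le> Re p \<and> 0 < Im p * (\<delta> / 2) \<longrightarrow> norm (P p - L1) < e"
    using primitive_limit_half_strip[OF G, of "\<delta> / 2" P] P \<delta> by auto
  obtain L2 where L2: "\<And>e. 0 < e \<Longrightarrow>
      \<exists>R. \<forall>p \<in> slit_strip \<delta>. R \<le> Re p \<and> 0 < Im p * (- \<delta> / 2) \<longrightarrow> norm (P p - L2) < e"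
    using primitive_limit_half_strip[OF G, of "- \<delta> / 2" P] P \<delta> by auto
  \<comment> \<open>Curves more general than rays are allowed, so that the same limit applies to a
    ray in the p-plane and to the image under \<open>Ln (1 + s)\<close> of a ray in the
    s-plane.\<close>
  have upper: "((\<lambda>x. P (q x)) \<longlongrightarrow> L1) at_top"
    if "\<forall>\<^sub>F x in at_top. q x \<in> slit_strip \<delta> \<and> 0 < Im (q x)" "filterlim (\<lambda>x. Re (q x)) at_top at_top"
    for q :: "real \<Rightarrow> complex"
  proof (rule tendstoI)
    fix e :: real assume "0 < e"
    then obtain R where R: "\<forall>p \<in> slit_strip \<delta>. R \<le> Re p \<and> 0 < Im p * (\<delta> / 2) \<longrightarrow> norm (P p - L1) < e"
      using L1 by blast
    have "\<forall>\<^sub>F x in at_top. R \<le> Re (q x)"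
      using that(2) by (simp add: filterlim_at_top)
    with that(1) show "\<forall>\<^sub>F x in at_top. dist (P (q x)) L1 < e"
      by eventually_elim (use R \<delta> in \<open>auto simp: dist_norm\<close>)
  qed
  have lower: "((\<lambda>x. P (q x)) \<longlongrightarrow> L2) at_top"
    if "\<forall>\<^sub>F x in at_top. q x \<in> slit_strip \<delta> \<and> Im (q x) < 0" "filterlim (\<lambda>x. Re (q x)) at_top at_top"
    for q :: "real \<Rightarrow> complex"
  proof (rule tendstoI)
    fix e :: real assume "0 < e"
    then obtain R where R: "\<forall>p \<in> slit_strip \<delta>. R \<le> Re p \<and> 0 < Im p * (- \<delta> / 2) \<longrightarrow> norm (P p - L2) < e"
      using L2 by blast
    have "\<forall>\<^sub>F x in at_top. R \<le> Re (q x)"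
      using that(2) by (simp add: filterlim_at_top)
    with that(1) show "\<forall>\<^sub>F x in at_top. dist (P (q x)) L2 < e"
      by eventually_elim (use R \<delta> in \<open>auto simp: dist_norm mult_neg_pos\<close>)
  qed
  have id_at_top: "filterlim (\<lambda>x::real. x) at_top at_top"
    by (rule filterlim_ident)
  show thesis
  proof (rule that[of "L1 - L2"])
    fix \<epsilon> assume \<epsilon>: "0 < \<epsilon>" "\<epsilon> < \<delta>"
    note ray = horizontal_ray_in_slit_strip[of _ \<delta>]
    have nn: "\<forall>\<^sub>F x::real in at_top. 0 \<le> x" by (rule eventually_ge_at_top)
    show "has_Gamma_integral G \<epsilon> (L1 - L2)"
    proof (rule has_Gamma_integral_primitive[OF \<epsilon> P])
      show "(\<lambda>x. G (of_real x + \<i> * of_real y)) absolutely_integrable_on {0..}" if "\<bar>y\<bar> = \<epsilon>" for y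
        using that \<epsilon> by (intro exp_decaying_imp_absolutely_integrable[OF G]) auto
      show "((\<lambda>x. P (of_real x + \<i> * of_real \<epsilon>)) \<longlongrightarrow> L1) at_top"
        by (intro upper eventually_mono[OF nn]) (use ray[of \<epsilon>] \<epsilon> id_at_top in auto)
      show "((\<lambda>x. P (of_real x - \<i> * of_real \<epsilon>)) \<longlongrightarrow> L2) at_top"
        by (intro lower eventually_mono[OF nn]) (use ray[of "- \<epsilon>"] \<epsilon> id_at_top in auto)
    qed
  next
    fix \<epsilon> assume \<epsilon>: "0 < \<epsilon>" "\<epsilon> < 1/2" "2 * \<epsilon> < \<delta>"
    \<comment> \<open>The midpoint of \<epsilon> and \<delta>/2, capped at 1/2: large enough for the
      contour of radius \<epsilon> to fit inside, small enough for the logarithm to map into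
      \<open>slit_strip \<delta>\<close>.\<close>
    define \<eta> where "\<eta> = min (1/2) ((\<epsilon> + \<delta> / 2) / 2)"
    have \<eta>: "\<epsilon> < \<eta>" "\<eta> \<le> 1/2" "2 * \<eta> < \<delta>"
      using \<epsilon> by (auto simp: \<eta>_def min_def)
    have sub: "slit_strip \<eta> \<subseteq> U \<eta> - \<real>\<^sub>\<ge>\<^sub>0" by (rule slit_strip_subset_U)
    note Ln_in = Ln_one_plus_in_slit_strip[OF _ \<eta>(2,3)]
    have cut: "1 + s \<notin> \<real>\<^sub>\<le>\<^sub>0" if "s \<in> slit_strip \<eta>" for s
      using Re_one_plus_ge_half[OF _ \<eta>(2,3), of s] that sub by (auto simp: complex_nonpos_Reals_iff)
    let ?g = "\<lambda>s. G (Ln (1 + s)) / (1 + s)"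
    have P': "((\<lambda>s. P (Ln (1 + s))) has_field_derivative ?g s) (at s)" if s: "s \<in> slit_strip \<eta>" for s
    proof -
      have "((\<lambda>s. Ln (1 + s)) has_field_derivative inverse (1 + s)) (at s)"
        using cut[OF s] by (auto intro!: derivative_eq_intros)
      with s sub have "((\<lambda>s. P (Ln (1 + s))) has_field_derivative G (Ln (1 + s)) * inverse (1 + s)) (at s)"
        by (intro DERIV_chain2[OF P] Ln_in) auto
      then show ?thesis by (simp add: divide_inverse)
    qed
    have g: "?g holomorphic_on slit_strip \<eta>"
      by (rule holomorphic_on_comp_Ln[OF G(1) \<eta>(2,3)])
    obtain K R where K: "0 \<le> K"
      "\<And>p. p \<in> slit_strip \<delta> \<Longrightarrow> R \<le> Re p \<Longrightarrow> norm (G p) \<le> K * exp (- Re p / 2)"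
      using G(2) by (auto simp: exp_decaying_def)
    have ray: "of_real x + \<i> * of_real y \<in> slit_strip \<eta>" if "\<bar>y\<bar> = \<epsilon>" "0 \<le> x" for x y
      using that \<epsilon> \<eta> by (intro horizontal_ray_in_slit_strip) auto
    have lim: "filterlim (\<lambda>x. Re (Ln (1 + (of_real x + \<i> * of_real y)))) at_top at_top" if "\<bar>y\<bar> = \<epsilon>" for y
    proof (rule filterlim_at_top_mono)
      \<comment> \<open>The real part of the logarithm is the logarithm of the norm, which dominates
        \<open>ln (1 + x)\<close>.\<close>
      show "filterlim (\<lambda>x::real. ln (1 + x)) at_top at_top" by real_asymp
      show "\<forall>\<^sub>F x in at_top. ln (1 + x) \<le> Re (Ln (1 + (of_real x + \<i> * of_real y)))"
        using eventually_ge_at_top[of 0]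
      proof eventually_elim
        case (elim x)
        let ?w = "1 + (of_real x + \<i> * of_real y)"
        have "1 + x \<le> norm ?w"
          using complex_Re_le_cmod[of ?w] by simp
        moreover from this have "?w \<noteq> 0" using elim by (metis norm_zero add_nonneg_pos add.commute not_le zero_less_one)
        ultimately show ?case using elim by (simp add: ln_mono)
      qed
    qed
    show "has_Gamma_integral ?g \<epsilon> (L1 - L2)"
    proof (rule has_Gamma_integral_primitive[OF \<epsilon>(1) \<eta>(1) P'])
      show "(\<lambda>x. ?g (of_real x + \<i> * of_real y)) absolutely_integrable_on {0..}" if y: "\<bar>y\<bar> = \<epsilon>" for y
      proof (rule absolutely_integrable_on_ray)
        show "continuous_on {0..} (\<lambda>x. ?g (of_real x + \<i> * of_real y))"
          using y \<epsilon> \<eta> by (intro continuous_on_horizontal_ray[OF g]) auto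
        show "norm (?g (of_real x + \<i> * of_real y)) \<le> K * x powr (-3/2)" if "exp R \<le> x" for x
        proof -
          have "0 \<le> x" using that exp_gt_zero[of R] by linarith
          then show ?thesis
            using norm_comp_Ln_le[where s = "of_real x + \<i> * of_real y", OF K _ _ \<eta>(2,3)] ray[OF y] sub that
            by auto
        qed
      qed
      \<comment> \<open>The logarithm preserves the sign of the imaginary part, so the image of the
        upper ray stays above the cut; likewise for the lower ray below.\<close>
      show "((\<lambda>x. P (Ln (1 + (of_real x + \<i> * of_real \<epsilon>)))) \<longlongrightarrow> L1) at_top"
      proof (rule upper[OF _ lim])
        show "\<forall>\<^sub>F x in at_top. Ln (1 + (of_real x + \<i> * of_real \<epsilon>)) \<in> slit_strip \<delta> \<and>
                0 < Im (Ln (1 + (of_real x + \<i> * of_real \<epsilon>)))"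
          using eventually_ge_at_top[of 0]
        proof eventually_elim
          case (elim x)
          then show ?case
            using Ln_in ray[of \<epsilon> x] sub \<epsilon> Im_Ln_pos_lt_imp[of "1 + (of_real x + \<i> * of_real \<epsilon>)"] by auto
        qed
      qed (use \<epsilon> in auto)
      have "((\<lambda>x. P (Ln (1 + (of_real x + \<i> * of_real (- \<epsilon>))))) \<longlongrightarrow> L2) at_top"
      proof (rule lower[OF _ lim])
        show "\<forall>\<^sub>F x in at_top. Ln (1 + (of_real x + \<i> * of_real (- \<epsilon>))) \<in> slit_strip \<delta> \<and>
                Im (Ln (1 + (of_real x + \<i> * of_real (- \<epsilon>)))) < 0"
          using eventually_ge_at_top[of 0]
        proof eventually_elim
          case (elim x)
          let ?w = "1 + (of_real x + \<i> * of_real (- \<epsilon>))"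
          have "Im ?w < 0" using \<epsilon> by simp
          then have "\<not> 0 \<le> Im (Ln ?w)"
            using Im_Ln_pos_le[of ?w] Ln_in[of "of_real x + \<i> * of_real (- \<epsilon>)"] Im_Ln_le_pi[of ?w] 
            by (metis not_le zero_complex.simps(2) less_irrefl)
          then show ?case
            using Ln_in ray[of "- \<epsilon>" x] sub \<epsilon> elim by auto
        qed
      qed (use \<epsilon> in auto)
      then show "((\<lambda>x. P (Ln (1 + (of_real x - \<i> * of_real \<epsilon>)))) \<longlongrightarrow> L2) at_top"
        by simp
    qed
  qed
qed

lemma U_subset_slit_strip: "\<eta> < \<delta> \<Longrightarrow> U \<eta> - \<real>\<^sub>\<ge>\<^sub>0 \<subseteq> slit_strip \<delta>"
  by (auto simp: slit_strip_def U_def)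

text \<open>The shared value \<open>I\<close> is the change of variables rule. Analyticity on the
  closed regions comes from holomorphy on a wider open strip, and the pointwise majorants depend
  only on the real part, so the decay is uniform. The statement for every \<epsilon> < \<delta> is
  kept because termwise integration needs one concrete contour for all terms.\<close>

lemma has_oint_exists:
  assumes \<delta>: "0 < \<delta>" and G: "G holomorphic_on slit_strip \<delta>" "exp_decaying \<delta> G"
  obtains I where "\<And>\<epsilon>. 0 < \<epsilon> \<Longrightarrow> \<epsilon> < \<delta> \<Longrightarrow> has_Gamma_integral G \<epsilon> I"
    and "G has_oint I" and "(\<lambda>s. G (Ln (1 + s)) / (1 + s)) has_oint I"
proof -
  obtain I where I: "\<And>\<epsilon>. 0 < \<epsilon> \<Longrightarrow> \<epsilon> < \<delta> \<Longrightarrow> has_Gamma_integral G \<epsilon> I"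
    and I': "\<And>\<epsilon>. 0 < \<epsilon> \<Longrightarrow> \<epsilon> < 1/2 \<Longrightarrow> 2 * \<epsilon> < \<delta> \<Longrightarrow>
           has_Gamma_integral (\<lambda>s. G (Ln (1 + s)) / (1 + s)) \<epsilon> I"
    by (rule Gamma_integral_exists[OF assms]) blast
  obtain K R where K: "0 \<le> K"
    "\<And>p. p \<in> slit_strip \<delta> \<Longrightarrow> R \<le> Re p \<Longrightarrow> norm (G p) \<le> K * exp (- Re p / 2)"
    using G(2) by (auto simp: exp_decaying_def)
  have analytic: "h analytic_on U (\<eta> / 2) - \<real>\<^sub>\<ge>\<^sub>0"
    if "h holomorphic_on slit_strip \<eta>" "0 < \<eta>" for h \<eta>
    using that U_subset_slit_strip[of "\<eta> / 2" \<eta>] analytic_on_open[OF open_slit_strip]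
      analytic_on_subset by (metis field_sum_of_halves less_add_same_cancel1 half_gt_zero)
  have vanish: "vanishes_at_infinity \<eta> h"
    if b: "(b \<longlongrightarrow> 0) at_top" and h: "\<And>s. s \<in> U \<eta> - \<real>\<^sub>\<ge>\<^sub>0 \<Longrightarrow> R \<le> Re s \<Longrightarrow> norm (h s) \<le> b (Re s)"
    for \<eta> h b R
    unfolding vanishes_at_infinity_def
  proof (intro allI impI)
    fix e :: real assume "0 < e"
    then obtain R' where "\<And>x. R' \<le> x \<Longrightarrow> b x < e"
      using order_tendstoD(2)[OF b] by (auto simp: eventually_at_top_linorder)
    then have "\<forall>s\<in>U \<eta> - \<real>\<^sub>\<ge>\<^sub>0. max R R' \<le> Re s \<longrightarrow> norm (h s) < e"
      using h by (meson le_less_trans max.bounded_iff)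
    then show "\<exists>R. \<forall>s\<in>U \<eta> - \<real>\<^sub>\<ge>\<^sub>0. R \<le> Re s \<longrightarrow> norm (h s) < e" ..
  qed
  show thesis
  proof (rule that[OF I])
    have "vanishes_at_infinity (\<delta> / 2) G"
    proof (rule vanish)
      show "((\<lambda>x. K * exp (- x / 2)) \<longlongrightarrow> 0) at_top" by real_asymp
      show "norm (G s) \<le> K * exp (- Re s / 2)" if "s \<in> U (\<delta> / 2) - \<real>\<^sub>\<ge>\<^sub>0" "R \<le> Re s" for s
        using K(2)[of s] that U_subset_slit_strip[of "\<delta> / 2" \<delta>] \<delta> by auto
    qed
    moreover have "\<forall>\<^sub>F \<epsilon> in at_right 0. has_Gamma_integral G \<epsilon> I"
      using eventually_at_right_less eventually_at_right_real[OF \<delta>]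
      by eventually_elim (use I in auto)
    ultimately show "G has_oint I"
      unfolding has_oint_def using analytic[OF G(1) \<delta>] \<delta> by (metis half_gt_zero)
  next
    let ?g = "\<lambda>s. G (Ln (1 + s)) / (1 + s)"
    \<comment> \<open>The bound \<delta>/4 gives 2\<eta> < \<delta>. Analyticity is then claimed
      only on \<open>U (\<eta> / 2)\<close> off the cut, which lies inside
      \<open>slit_strip \<eta>\<close>.\<close>
    define \<eta> where "\<eta> = min (1/2) (\<delta> / 4)"
    have \<eta>: "0 < \<eta>" "\<eta> / 2 \<le> 1/2" "2 * (\<eta> / 2) < \<delta>" "\<eta> \<le> 1/2" "2 * \<eta> < \<delta>"
      using \<delta> by (auto simp: \<eta>_def min_def)
    have "vanishes_at_infinity (\<eta> / 2) ?g"
    proof (rule vanish)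
      show "((\<lambda>x. K * x powr (-3/2)) \<longlongrightarrow> 0) at_top" by real_asymp
      show "norm (?g s) \<le> K * Re s powr (-3/2)" if "s \<in> U (\<eta> / 2) - \<real>\<^sub>\<ge>\<^sub>0" "exp R \<le> Re s" for s
        by (rule norm_comp_Ln_le[OF K that \<eta>(2,3)])
    qed
    moreover have "\<forall>\<^sub>F \<epsilon> in at_right 0. has_Gamma_integral ?g \<epsilon> I"
      using eventually_at_right_real[OF \<eta>(1)]
      by eventually_elim (use I' \<eta> in auto)
    ultimately show "?g has_oint I"
      unfolding has_oint_def
      using analytic[OF holomorphic_on_comp_Ln[OF G(1) \<eta>(4,5)] \<eta>(1)] \<eta>(1) by (metis half_gt_zero)
  qed
qed

section \<open>Linearity of the integrals\<close>

lemma vanishes_at_infinity_mono: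
  "vanishes_at_infinity \<delta> g \<Longrightarrow> \<eta> \<le> \<delta> \<Longrightarrow> vanishes_at_infinity \<eta> g"
  unfolding vanishes_at_infinity_def U_def by force

lemma vanishes_at_infinity_add:
  assumes "vanishes_at_infinity \<delta> g" "vanishes_at_infinity \<delta> h"
  shows "vanishes_at_infinity \<delta> (\<lambda>s. g s + h s)"
  unfolding vanishes_at_infinity_def
proof (intro allI impI)
  fix e :: real assume "0 < e"
  then obtain R S where R: "\<forall>s\<in>U \<delta> - \<real>\<^sub>\<ge>\<^sub>0. R \<le> Re s \<longrightarrow> norm (g s) < e / 2"
    and S: "\<forall>s\<in>U \<delta> - \<real>\<^sub>\<ge>\<^sub>0. S \<le> Re s \<longrightarrow> norm (h s) < e / 2"
    using assms unfolding vanishes_at_infinity_def by (meson half_gt_zero)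
  show "\<exists>R. \<forall>s\<in>U \<delta> - \<real>\<^sub>\<ge>\<^sub>0. R \<le> Re s \<longrightarrow> norm (g s + h s) < e"
  proof (intro exI[of _ "max R S"] ballI impI)
    fix s assume "s \<in> U \<delta> - \<real>\<^sub>\<ge>\<^sub>0" "max R S \<le> Re s"
    then show "norm (g s + h s) < e"
      using R S norm_triangle_lt[of "g s" "h s" e] by force
  qed
qed

lemma has_Gamma_integralI:
  assumes "((\<lambda>x::real. g (of_real x - \<i> * of_real \<epsilon>)) has_integral A) {0..}"
    and "(g has_contour_integral B) (part_circlepath 0 \<epsilon> (3 * pi / 2) (pi / 2))"
    and "((\<lambda>x::real. g (of_real x + \<i> * of_real \<epsilon>)) has_integral C) {0..}"
    and "I = - A + B + C"
  shows "has_Gamma_integral g \<epsilon> I"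
  using assms unfolding has_Gamma_integral_def by blast

lemma has_Gamma_integralE:
  assumes "has_Gamma_integral g \<epsilon> I"
  obtains A B C where "((\<lambda>x::real. g (of_real x - \<i> * of_real \<epsilon>)) has_integral A) {0..}"
    and "(g has_contour_integral B) (part_circlepath 0 \<epsilon> (3 * pi / 2) (pi / 2))"
    and "((\<lambda>x::real. g (of_real x + \<i> * of_real \<epsilon>)) has_integral C) {0..}"
    and "I = - A + B + C"
  using assms unfolding has_Gamma_integral_def by blast

lemma has_Gamma_integral_add:
  assumes "has_Gamma_integral g \<epsilon> I" "has_Gamma_integral h \<epsilon> J"
  shows "has_Gamma_integral (\<lambda>s. g s + h s) \<epsilon> (I + J)"
  using assms by (elim has_Gamma_integralE)
    (rule has_Gamma_integralI[OF has_integral_add has_contour_integral_add has_integral_add], auto)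

lemma has_Gamma_integral_zero: "has_Gamma_integral (\<lambda>s. 0) \<epsilon> 0"
  by (rule has_Gamma_integralI[of _ _ 0 0 0]) (auto intro: has_contour_integral_0)

lemma has_Gamma_integral_cmult:
  assumes "has_Gamma_integral g \<epsilon> I"
  shows "has_Gamma_integral (\<lambda>s. c * g s) \<epsilon> (c * I)"
  using assms by (elim has_Gamma_integralE)
    (rule has_Gamma_integralI[OF has_integral_mult_right has_contour_integral_lmul
        has_integral_mult_right], auto simp: distrib_left right_diff_distrib)

lemma has_Gamma_integral_sum:
  assumes "finite S" "\<And>i. i \<in> S \<Longrightarrow> has_Gamma_integral (g i) \<epsilon> (I i)"
  shows "has_Gamma_integral (\<lambda>s. \<Sum>i\<in>S. g i s) \<epsilon> (\<Sum>i\<in>S. I i)"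
  using assms by (induction S) (auto intro: has_Gamma_integral_add has_Gamma_integral_zero)

text \<open>The two integrands may come with different widths; both are restricted to the smaller
  one.\<close>

lemma has_oint_add:
  assumes "g has_oint I" "h has_oint J"
  shows "(\<lambda>s. g s + h s) has_oint (I + J)"
proof -
  obtain \<delta> \<eta> where "0 < \<delta>" "g analytic_on U \<delta> - \<real>\<^sub>\<ge>\<^sub>0" "vanishes_at_infinity \<delta> g"
    and "0 < \<eta>" "h analytic_on U \<eta> - \<real>\<^sub>\<ge>\<^sub>0" "vanishes_at_infinity \<eta> h"
    using assms unfolding has_oint_def by blast
  moreover have "U (min \<delta> \<eta>) \<subseteq> U \<delta>" "U (min \<delta> \<eta>) \<subseteq> U \<eta>"
    by (auto simp: U_def)
  ultimately have "(\<lambda>s. g s + h s) analytic_on U (min \<delta> \<eta>) - \<real>\<^sub>\<ge>\<^sub>0"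
    "vanishes_at_infinity (min \<delta> \<eta>) (\<lambda>s. g s + h s)" "0 < min \<delta> \<eta>"
    by (auto intro!: analytic_on_add vanishes_at_infinity_add
        elim: analytic_on_subset vanishes_at_infinity_mono)
  moreover have "\<forall>\<^sub>F \<epsilon> in at_right 0. has_Gamma_integral (\<lambda>s. g s + h s) \<epsilon> (I + J)"
    using assms unfolding has_oint_def
    by (auto elim: eventually_elim2 intro: has_Gamma_integral_add)
  ultimately show ?thesis
    unfolding has_oint_def by blast
qed

lemma has_oint_zero: "(\<lambda>s. 0) has_oint 0"
  unfolding has_oint_def vanishes_at_infinity_def
  by (auto intro!: exI[of _ 1] simp: has_Gamma_integral_zero)

lemma has_oint_sum:
  assumes "finite S" "\<And>i. i \<in> S \<Longrightarrow> g i has_oint I i"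
  shows "(\<lambda>s. \<Sum>i\<in>S. g i s) has_oint (\<Sum>i\<in>S. I i)"
  using assms by (induction S) (auto intro: has_oint_add has_oint_zero)

section \<open>Dominated convergence over the contour\<close>

text \<open>Dominated convergence is applied to each piece. On the rays \<open>H\<close> itself is
  the majorant; on the semicircle continuity and compactness bound \<open>H\<close> by a constant.
  The estimate is required only for Re p \<ge> -\<epsilon>, a half-plane containing the whole
  contour.\<close>

lemma has_Gamma_integral_dominated_convergence:
  assumes \<epsilon>: "0 < \<epsilon>" "\<epsilon> < \<delta>"
    and S: "\<And>n. has_Gamma_integral (S n) \<epsilon> (J n)" and G: "has_Gamma_integral G \<epsilon> I"
    and lim: "\<And>p. p \<in> slit_strip \<delta> \<Longrightarrow> (\<lambda>n. S n p) \<longlonglongrightarrow> G p"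
    and le: "\<And>n p. p \<in> slit_strip \<delta> \<Longrightarrow> - \<epsilon> \<le> Re p \<Longrightarrow> norm (S n p) \<le> H p"
    and H: "\<And>y. \<bar>y\<bar> = \<epsilon> \<Longrightarrow> (\<lambda>x. H (of_real x + \<i> * of_real y)) integrable_on {0..}"
    and H_cont: "continuous_on (slit_strip \<delta>) H"
  shows "J \<longlonglongrightarrow> I"
proof -
  let ?\<gamma> = "part_circlepath 0 \<epsilon> (3 * pi / 2) (pi / 2)"
  obtain A B C where ABC:
    "\<And>n. ((\<lambda>x. S n (of_real x - \<i> * of_real \<epsilon>)) has_integral A n) {0..}"
    "\<And>n. (S n has_contour_integral B n) ?\<gamma>"
    "\<And>n. ((\<lambda>x. S n (of_real x + \<i> * of_real \<epsilon>)) has_integral C n) {0..}"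
    "\<And>n. J n = - A n + B n + C n"
    using S unfolding has_Gamma_integral_def by metis
  obtain A' B' C' where ABC':
    "((\<lambda>x. G (of_real x - \<i> * of_real \<epsilon>)) has_integral A') {0..}"
    "(G has_contour_integral B') ?\<gamma>"
    "((\<lambda>x. G (of_real x + \<i> * of_real \<epsilon>)) has_integral C') {0..}"
    "I = - A' + B' + C'"
    using G unfolding has_Gamma_integral_def by blast
  have ray: "a \<longlonglongrightarrow> a'"
    if y: "\<bar>y\<bar> = \<epsilon>" and a: "\<And>n. ((\<lambda>x. S n (of_real x + \<i> * of_real y)) has_integral a n) {0..}"
      and a': "((\<lambda>x. G (of_real x + \<i> * of_real y)) has_integral a') {0..}" for a a' y
  proof -
    have in_strip: "of_real x + \<i> * of_real y \<in> slit_strip \<delta>" if "x \<in> {0..}" for x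
      using that y \<epsilon> by (intro horizontal_ray_in_slit_strip) auto
    have "(\<lambda>n. integral {0..} (\<lambda>x. S n (of_real x + \<i> * of_real y))) \<longlonglongrightarrow>
        integral {0..} (\<lambda>x. G (of_real x + \<i> * of_real y))"
      using a in_strip \<epsilon>
      by (intro dominated_convergence(2)[OF _ H[OF y]] lim le) auto
    then show ?thesis
      by (simp add: integral_unique[OF a] integral_unique[OF a'])
  qed
  have "B \<longlonglongrightarrow> B'"
  proof -
    have \<gamma>: "?\<gamma> t \<in> slit_strip \<delta>" "Re (?\<gamma> t) \<ge> - \<epsilon>" "?\<gamma> t \<in> path_image ?\<gamma>" if "t \<in> {0..1}" for t
    proof -
      show *: "?\<gamma> t \<in> path_image ?\<gamma>" using that by (auto simp: path_image_def)
      then show "?\<gamma> t \<in> slit_strip \<delta>" using semicircle_in_slit_strip[OF \<epsilon>] by blast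
      have "norm (?\<gamma> t) = \<epsilon>"
        using * path_image_part_circlepath_subset'[of \<epsilon> 0 "3 * pi / 2" "pi / 2"] \<epsilon> by auto
      then show "Re (?\<gamma> t) \<ge> - \<epsilon>" using abs_Re_le_cmod[of "?\<gamma> t"] by linarith
    qed
    have "compact (H ` path_image ?\<gamma>)"
      by (intro compact_continuous_image continuous_on_subset[OF H_cont]
          semicircle_in_slit_strip[OF \<epsilon>] compact_path_image path_part_circlepath)
    then have "bdd_above (H ` path_image ?\<gamma>)"
      by (intro bounded_imp_bdd_above compact_imp_bounded)
    then obtain M where M: "\<And>w. w \<in> path_image ?\<gamma> \<Longrightarrow> H w \<le> M"
      by (auto simp: bdd_above_def)
    let ?d = "\<lambda>t. vector_derivative ?\<gamma> (at t within {0..1})"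
    have "(\<lambda>n. integral {0..1} (\<lambda>t. S n (?\<gamma> t) * ?d t)) \<longlonglongrightarrow> integral {0..1} (\<lambda>t. G (?\<gamma> t) * ?d t)"
    proof (rule dominated_convergence(2))
      show "(\<lambda>t. S n (?\<gamma> t) * ?d t) integrable_on {0..1}" for n
        using ABC(2)[of n] unfolding has_contour_integral_def by blast
      \<comment> \<open>The factor \<epsilon> * pi is the constant speed of the parametrization:
        radius times the angle swept over the unit interval.\<close>
      show "(\<lambda>t. M * (\<epsilon> * pi)) integrable_on {0..1::real}" by auto
      show "norm (S n (?\<gamma> t) * ?d t) \<le> M * (\<epsilon> * pi)" if "t \<in> {0..1}" for n t
      proof -
        have "norm (S n (?\<gamma> t)) \<le> M"
          using le[of "?\<gamma> t" n] M[of "?\<gamma> t"] \<gamma>[OF that] by linarith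
        moreover have "norm (?d t) = \<epsilon> * pi"
        proof -
          have "norm (exp (\<i> * linepath (of_real (3 * pi / 2)) (of_real (pi / 2)) t)) = 1"
            by (simp add: linepath_def)
          moreover have "norm (complex_of_real (pi / 2) - complex_of_real (3 * pi / 2)) = pi"
            by (simp flip: of_real_diff)
          ultimately show ?thesis
            using that \<epsilon> by (simp add: vector_derivative_part_circlepath01 norm_mult)
        qed
        ultimately show ?thesis
          using \<epsilon> by (simp add: norm_mult mult_right_mono)
      qed
      show "(\<lambda>n. S n (?\<gamma> t) * ?d t) \<longlonglongrightarrow> G (?\<gamma> t) * ?d t" if "t \<in> {0..1}" for t
        by (intro tendsto_intros lim \<gamma> that)
    qed
    then show ?thesis
      by (simp add: integral_unique[OF ABC(2)[unfolded has_contour_integral_def]]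
          integral_unique[OF ABC'(2)[unfolded has_contour_integral_def]])
  qed
  moreover have "A \<longlonglongrightarrow> A'" "C \<longlonglongrightarrow> C'"
    using ray[of "- \<epsilon>" A A'] ray[of \<epsilon> C C'] ABC(1,3) ABC'(1,3) \<epsilon> by auto
  ultimately show ?thesis
    unfolding ABC(4)[abs_def] ABC'(4) by (intro tendsto_intros)
qed

section \<open>Growth bounds and the exponential series\<close>

lemma algebraically_bounded_imp_exp_bound:
  assumes "algebraically_bounded \<delta> F"
  obtains K R where "0 \<le> K"
    and "\<And>p. p \<in> slit_strip \<delta> \<Longrightarrow> R \<le> Re p \<Longrightarrow> norm (F p) \<le> K * exp (Re p / 2)"
proof -
  obtain C m R where F: "\<And>p. p \<in> U \<delta> - \<real>\<^sub>\<ge>\<^sub>0 \<Longrightarrow> R \<le> norm p \<Longrightarrow> norm (F p) \<le> C * norm p powr m"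
    using assms unfolding algebraically_bounded_def by blast
  have "\<forall>\<^sub>F x::real in at_top. (2 * x) powr \<bar>m\<bar> \<le> exp (x / 2)"
    by real_asymp
  then obtain R' where R': "\<And>x::real. R' \<le> x \<Longrightarrow> (2 * x) powr \<bar>m\<bar> \<le> exp (x / 2)"
    by (auto simp: eventually_at_top_linorder)
  have "norm (F p) \<le> \<bar>C\<bar> * exp (Re p / 2)"
    \<comment> \<open>Beyond \<delta> the imaginary part is dominated by the real part, so the norm
      is at most \<open>2 * Re p\<close>; beyond 1 powers increase with the exponent, so that
      \<open>m\<close> may be replaced by its absolute value.\<close>
    if p: "p \<in> slit_strip \<delta>" and Re: "max (max 1 \<delta>) (max R R') \<le> Re p" for p
  proof -
    have n: "Re p \<le> norm p" "norm p \<le> 2 * Re p"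
      using complex_Re_le_cmod[of p] cmod_le[of p] p Re by (auto simp: slit_strip_def)
    have "norm (F p) \<le> C * norm p powr m"
      using p slit_strip_subset_U Re n by (intro F) auto
    also have "\<dots> \<le> \<bar>C\<bar> * norm p powr \<bar>m\<bar>"
      using n Re by (intro mult_mono powr_mono) auto
    also have "\<dots> \<le> \<bar>C\<bar> * (2 * Re p) powr \<bar>m\<bar>"
      using n by (intro mult_left_mono powr_mono2) auto
    also have "\<dots> \<le> \<bar>C\<bar> * exp (Re p / 2)"
      using R' Re by (intro mult_left_mono) auto
    finally show ?thesis .
  qed
  then show thesis
    by (intro that[of "\<bar>C\<bar>" "max (max 1 \<delta>) (max R R')"]) auto
qed

lemma exp_decaying_mult:
  assumes "algebraically_bounded \<delta> F"
    and "\<And>p. 0 \<le> Re p \<Longrightarrow> norm (h p) \<le> B * exp (- Re p)"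
  shows "exp_decaying \<delta> (\<lambda>p. h p * F p)"
proof -
  obtain K R where K: "0 \<le> K"
    "\<And>p. p \<in> slit_strip \<delta> \<Longrightarrow> R \<le> Re p \<Longrightarrow> norm (F p) \<le> K * exp (Re p / 2)"
    by (rule algebraically_bounded_imp_exp_bound[OF assms(1)]) blast
  \<comment> \<open>The hypothesis at 0 forces the constant to be nonnegative.\<close>
  have B: "0 \<le> B"
    using order_trans[OF norm_ge_zero assms(2)[of 0]] by simp
  have "norm (h p * F p) \<le> B * K * exp (- Re p / 2)"
    if "p \<in> slit_strip \<delta>" "max 0 R \<le> Re p" for p
  proof -
    have "norm (h p * F p) \<le> (B * exp (- Re p)) * (K * exp (Re p / 2))"
      unfolding norm_mult using that B by (intro mult_mono assms(2) K(2)) auto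
    also have "\<dots> = B * K * (exp (- Re p) * exp (Re p / 2))"
      by simp
    also have "exp (- Re p) * exp (Re p / 2) = exp (- Re p / 2)"
      by (simp flip: exp_add)
    finally show ?thesis .
  qed
  then show ?thesis
    unfolding exp_decaying_def using B K(1) by (intro exI[of _ "B * K"] exI[of _ "max 0 R"]) auto
qed

lemma exp_minus_one_sums:
  fixes w :: complex
  shows "(\<lambda>k. w ^ Suc k / fact (Suc k)) sums (exp w - 1)"
proof -
  have "(\<lambda>k. w ^ k / fact k) sums exp w"
    using exp_converges[of w] by (simp add: divide_inverse scaleR_conv_of_real mult.commute)
  then show ?thesis
    using sums_split_initial_segment[of "\<lambda>k. w ^ k / fact k" "exp w" 1] by simp
qed

text \<open>One factor \<open>norm w\<close> is pulled out and \<open>fact (Suc k)\<close> is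
  weakened to \<open>fact k\<close>. Keeping that factor is essential: for
  \<open>w = c * exp (- p)\<close> it supplies the decay \<open>exp (- Re p)\<close>, uniformly in
  the number of terms.\<close>

lemma norm_exp_minus_one_partial_sum_le:
  fixes w :: complex
  shows "norm (\<Sum>k<n. w ^ Suc k / fact (Suc k)) \<le> norm w * exp (norm w)"
proof -
  have "norm (\<Sum>k<n. w ^ Suc k / fact (Suc k)) \<le> (\<Sum>k<n. norm w * (norm w ^ k / fact k))"
  proof (rule sum_norm_le)
    fix k
    have "norm w * norm w ^ k / fact (Suc k) \<le> norm w * norm w ^ k / fact k"
      by (intro divide_left_mono fact_mono mult_nonneg_nonneg) auto
    then show "norm (w ^ Suc k / fact (Suc k)) \<le> norm w * (norm w ^ k / fact k)"
      by (simp add: norm_divide norm_mult norm_power del: fact_Suc)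
  qed
  also have "\<dots> = norm w * (\<Sum>k<n. norm w ^ k / fact k)"
    by (simp add: sum_distrib_left)
  also have "(\<Sum>k<n. norm w ^ k / fact k) \<le> exp (norm w)"
  proof -
    have "(\<lambda>k. norm w ^ k / fact k) sums exp (norm w)"
      using exp_converges[of "norm w"] by (simp add: divide_inverse mult.commute)
    then show ?thesis
      using sum_le_suminf[of "\<lambda>k. norm w ^ k / fact k" "{..<n}"] by (simp add: sums_iff)
  qed
  finally show ?thesis by (simp add: mult_left_mono)
qed

lemma norm_exp_minus_one_le:
  fixes w :: complex
  shows "norm (exp w - 1) \<le> norm w * exp (norm w)"
  by (rule LIMSEQ_le_const2[OF tendsto_norm[OF exp_minus_one_sums[unfolded sums_def]]])
    (use norm_exp_minus_one_partial_sum_le in blast)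

section \<open>Termwise integration for a single summand\<close>

text \<open>This is the contribution of one index j, with \<open>c\<close> standing for z / a_j. In
  the p-plane \<open>c / (1 + s)\<close> becomes \<open>c * exp (- p)\<close>, and the exponential
  series turns the integrand into a series in \<open>exp (- k p) * F p\<close> with k \<ge> 1, whose
  partial sums have an integrable majorant on a fixed contour.\<close>

lemma Borel_term_expansion:
  fixes F :: "complex \<Rightarrow> complex"
  assumes \<delta>: "0 < \<delta>" and F: "F analytic_on U \<delta> - \<real>\<^sub>\<ge>\<^sub>0" "algebraically_bounded \<delta> F"
  obtains I where "(\<lambda>s. (exp (c / (1 + s)) - 1) * (F (Ln (1 + s)) / (1 + s))) has_oint I"
    and "(\<lambda>k. c ^ Suc k / fact (Suc k) * oint (\<lambda>p. exp (- of_nat (Suc k) * p) * F p)) sums I"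
proof -
  have holF: "F holomorphic_on slit_strip \<delta>"
    using analytic_imp_holomorphic[OF F(1)] holomorphic_on_subset slit_strip_subset_U by blast
  define h where "h = (\<lambda>p. exp (c * exp (- p)) - 1)"
  define G where "G = (\<lambda>p. h p * F p)"
  define E where "E = (\<lambda>k p. exp (- of_nat (Suc k) * p) * F p)"
  have holG: "G holomorphic_on slit_strip \<delta>"
    unfolding G_def h_def by (intro holomorphic_intros holF)
  have holE: "E k holomorphic_on slit_strip \<delta>" for k
    unfolding E_def by (intro holomorphic_intros holF)
  have decG: "exp_decaying \<delta> G"
    unfolding G_def
  proof (rule exp_decaying_mult[OF F(2)])
    fix p :: complex assume "0 \<le> Re p"
    then have "norm (c * exp (- p)) \<le> norm c"
      by (simp add: norm_mult mult_left_le)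
    then have "norm (c * exp (- p)) * exp (norm (c * exp (- p))) \<le> norm (c * exp (- p)) * exp (norm c)"
      by (intro mult_left_mono) auto
    with norm_exp_minus_one_le[of "c * exp (- p)"]
    show "norm (h p) \<le> norm c * exp (norm c) * exp (- Re p)"
      by (simp add: h_def norm_mult mult_ac)
  qed
  have decE: "exp_decaying \<delta> (E k)" for k
    unfolding E_def
  proof (rule exp_decaying_mult[OF F(2)])
    fix p :: complex assume "0 \<le> Re p"
    then have "1 * Re p \<le> real (Suc k) * Re p"
      by (intro mult_right_mono) auto
    then show "norm (exp (- of_nat (Suc k) * p)) \<le> 1 * exp (- Re p)"
      by (simp add: algebra_simps)
  qed
  obtain I where I: "\<And>\<epsilon>. 0 < \<epsilon> \<Longrightarrow> \<epsilon> < \<delta> \<Longrightarrow> has_Gamma_integral G \<epsilon> I"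
    "(\<lambda>s. G (Ln (1 + s)) / (1 + s)) has_oint I"
    by (rule has_oint_exists[OF \<delta> holG decG]) blast
  have E: "has_Gamma_integral (E k) \<epsilon> (oint (E k))" if "0 < \<epsilon>" "\<epsilon> < \<delta>" for k \<epsilon>
    by (rule has_oint_exists[OF \<delta> holE[of k] decE[of k]]) (use that in \<open>simp add: oint_eqI\<close>)
  have "(\<lambda>s. G (Ln (1 + s)) / (1 + s)) = (\<lambda>s. (exp (c / (1 + s)) - 1) * (F (Ln (1 + s)) / (1 + s)))"
  proof
    fix s
    show "G (Ln (1 + s)) / (1 + s) = (exp (c / (1 + s)) - 1) * (F (Ln (1 + s)) / (1 + s))"
      \<comment> \<open>At s = -1 both sides are 0 since division by zero yields 0; elsewhere
        \<open>exp (- Ln (1 + s))\<close> is \<open>1 / (1 + s)\<close>.\<close>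
      by (cases "1 + s = 0") (simp_all add: G_def h_def exp_minus divide_inverse)
  qed
  then have 1: "(\<lambda>s. (exp (c / (1 + s)) - 1) * (F (Ln (1 + s)) / (1 + s))) has_oint I"
    using I(2) by (simp only:)
  \<comment> \<open>A single radius suffices: the value \<open>I\<close> and every
    \<open>oint (E k)\<close> are already known to be integrals over the contour of any radius below
    \<delta>.\<close>
  define \<epsilon> where "\<epsilon> = \<delta> / 2"
  have \<epsilon>: "0 < \<epsilon>" "\<epsilon> < \<delta>" using \<delta> by (auto simp: \<epsilon>_def)
  define S where "S = (\<lambda>n p. \<Sum>k<n. c ^ Suc k / fact (Suc k) * E k p)"
  \<comment> \<open>On the contour Re p \<ge> -\<epsilon>, so \<open>norm (c * exp (- p))\<close> is
    at most \<open>norm c * exp \<epsilon>\<close> inside the exponential. The linear factor outside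
    leaves \<open>norm c * exp (- Re p)\<close>, and \<open>exp (- Re p) * norm (F p)\<close> is
    \<open>norm (E 0 p)\<close>.\<close>
  define B where "B = norm c * exp (norm c * exp \<epsilon>)"
  have S_eq: "S n p = (\<Sum>k<n. (c * exp (- p)) ^ Suc k / fact (Suc k)) * F p" for n p
    unfolding S_def E_def sum_distrib_right
  proof (intro sum.cong refl)
    fix k
    have "exp (- of_nat (Suc k) * p) = exp (- p) ^ Suc k"
      by (metis exp_of_nat_mult mult_minus_left mult_minus_right)
    then show "c ^ Suc k / fact (Suc k) * (exp (- of_nat (Suc k) * p) * F p) =
        (c * exp (- p)) ^ Suc k / fact (Suc k) * F p"
      by (simp only: power_mult_distrib) (simp del: fact_Suc power_Suc)
  qed
  have "(\<lambda>n. \<Sum>k<n. c ^ Suc k / fact (Suc k) * oint (E k)) \<longlonglongrightarrow> I"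
  proof (rule has_Gamma_integral_dominated_convergence[OF \<epsilon>, where S = S and G = G
        and H = "\<lambda>p. B * norm (E 0 p)"])
    show "has_Gamma_integral (S n) \<epsilon> (\<Sum>k<n. c ^ Suc k / fact (Suc k) * oint (E k))" for n
      unfolding S_def by (intro has_Gamma_integral_sum has_Gamma_integral_cmult E \<epsilon>) auto
    show "has_Gamma_integral G \<epsilon> I" by (rule I(1)[OF \<epsilon>])
    show "(\<lambda>n. S n p) \<longlonglongrightarrow> G p" for p
      unfolding S_eq G_def h_def
      using exp_minus_one_sums[of "c * exp (- p)"] by (intro tendsto_intros) (simp add: sums_def)
    show "norm (S n p) \<le> B * norm (E 0 p)" if "- \<epsilon> \<le> Re p" for n p
    proof -
      let ?w = "c * exp (- p)"
      have "norm ?w \<le> norm c * exp \<epsilon>"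
        using that by (auto simp: norm_mult intro: mult_left_mono)
      then have "norm ?w * exp (norm ?w) \<le> norm ?w * exp (norm c * exp \<epsilon>)"
        by (intro mult_left_mono) auto
      with norm_exp_minus_one_partial_sum_le[of ?w n]
      have "norm (\<Sum>k<n. ?w ^ Suc k / fact (Suc k)) \<le> norm ?w * exp (norm c * exp \<epsilon>)"
        by linarith
      also have "\<dots> = B * exp (- Re p)"
        by (simp add: B_def norm_mult)
      finally have "norm (S n p) \<le> B * exp (- Re p) * norm (F p)"
        unfolding S_eq norm_mult by (rule mult_right_mono) simp
      then show ?thesis
        by (simp add: E_def norm_mult mult.assoc)
    qed
    show "(\<lambda>x. B * norm (E 0 (of_real x + \<i> * of_real y))) integrable_on {0..}" if "\<bar>y\<bar> = \<epsilon>" for y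
    proof -
      have "(\<lambda>x. E 0 (of_real x + \<i> * of_real y)) absolutely_integrable_on {0..}"
        using that \<epsilon> by (intro exp_decaying_imp_absolutely_integrable[OF holE decE]) auto
      then show ?thesis
        unfolding absolutely_integrable_on_def
        using has_integral_integrable[OF has_integral_mult_right[OF integrable_integral]] by blast
    qed
    show "continuous_on (slit_strip \<delta>) (\<lambda>p. B * norm (E 0 p))"
      by (intro continuous_intros holomorphic_on_imp_continuous_on holE)
  qed
  then have 2: "(\<lambda>k. c ^ Suc k / fact (Suc k) * oint (E k)) sums I"
    by (simp add: sums_def)
  show thesis
    using that[OF 1] 2 by (simp only: E_def)
qed

section \<open>Summation over the singular directions\<close>

theorem theorem2p2:
  fixes N :: nat
    and a :: "nat \<Rightarrow> complex"
    and \<delta> :: real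
    and F :: "nat \<Rightarrow> complex \<Rightarrow> complex"
    and c :: "nat \<Rightarrow> complex"
    and f :: "complex \<Rightarrow> complex"
    and z :: complex
  assumes "\<forall>j\<in>{1..N}. a j \<noteq> 0"
    and "inj_on (\<lambda>j. Arg (a j)) {1..N}"
    and "\<delta> > 0"
    and "\<forall>j\<in>{1..N}. F j analytic_on (U \<delta> - \<real>\<^sub>\<ge>\<^sub>0)"
    and "\<forall>j\<in>{1..N}. algebraically_bounded \<delta> (F j)"
    and "\<forall>k\<ge>1. c k = (\<Sum>j=1..N. a j powi (- int k) * oint (\<lambda>p. exp (- of_nat k * p) * F j p))"
    and "0 < conv_radius c" and "conv_radius c < \<infinity>"
    and "\<forall>w. (\<lambda>k. c (Suc k) * w ^ Suc k / fact (Suc k)) sums f w"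
  shows "(\<lambda>s. \<Sum>j=1..N. (exp (z / (a j * (1 + s))) - 1) * (F j (Ln (1 + s)) / (1 + s)))
           has_oint f z"
proof -
  let ?o = "\<lambda>k j. oint (\<lambda>p. exp (- of_nat (Suc k) * p) * F j p)"
  have *: "\<exists>I. (\<lambda>s. (exp (z / a j / (1 + s)) - 1) * (F j (Ln (1 + s)) / (1 + s))) has_oint I \<and>
      (\<lambda>k. (z / a j) ^ Suc k / fact (Suc k) * ?o k j) sums I" if "j \<in> {1..N}" for j
  proof -
    have "F j analytic_on U \<delta> - \<real>\<^sub>\<ge>\<^sub>0" "algebraically_bounded \<delta> (F j)"
      using assms(4,5) that by auto
    then show ?thesis
      by (rule Borel_term_expansion[OF assms(3), of "F j" "z / a j"]) (rule exI, rule conjI)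
  qed
  have "\<exists>I. \<forall>j\<in>{1..N}.
      (\<lambda>s. (exp (z / a j / (1 + s)) - 1) * (F j (Ln (1 + s)) / (1 + s))) has_oint I j \<and>
      (\<lambda>k. (z / a j) ^ Suc k / fact (Suc k) * ?o k j) sums I j"
    by (intro bchoice ballI *)
  then obtain I where I: "\<forall>j\<in>{1..N}.
      (\<lambda>s. (exp (z / a j / (1 + s)) - 1) * (F j (Ln (1 + s)) / (1 + s))) has_oint I j \<and>
      (\<lambda>k. (z / a j) ^ Suc k / fact (Suc k) * ?o k j) sums I j" ..
  have "(\<lambda>k. \<Sum>j=1..N. (z / a j) ^ Suc k / fact (Suc k) * ?o k j) sums (\<Sum>j=1..N. I j)"
    by (intro sums_sum) (use I in blast)
  \<comment> \<open>Collecting equal powers of z over all j reproduces the formula for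
    \<open>c (Suc k)\<close>, so the finite sum of the expansions is the defining series of
    \<open>f z\<close>.\<close>
  moreover have "(\<Sum>j=1..N. (z / a j) ^ Suc k / fact (Suc k) * ?o k j) =
      c (Suc k) * z ^ Suc k / fact (Suc k)" for k
  proof -
    have "c (Suc k) = (\<Sum>j=1..N. a j powi (- int (Suc k)) * ?o k j)"
      by (rule assms(6)[rule_format]) simp
    also have "\<dots> * z ^ Suc k / fact (Suc k) =
        (\<Sum>j=1..N. (z / a j) ^ Suc k / fact (Suc k) * ?o k j)"
      unfolding sum_distrib_right sum_divide_distrib
    proof (intro sum.cong refl)
      fix j
      have "a j powi (- int (Suc k)) = inverse (a j ^ Suc k)"
        by (simp only: power_int_minus power_int_of_nat)
      moreover have "(z / a j) ^ Suc k = z ^ Suc k * inverse (a j ^ Suc k)"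
        by (subst power_divide) (rule divide_inverse)
      ultimately show "a j powi (- int (Suc k)) * ?o k j * z ^ Suc k / fact (Suc k) =
          (z / a j) ^ Suc k / fact (Suc k) * ?o k j"
        by (simp only:) (simp only: divide_inverse mult_ac)
    qed
    finally show ?thesis ..
  qed
  ultimately have "(\<lambda>k. c (Suc k) * z ^ Suc k / fact (Suc k)) sums (\<Sum>j=1..N. I j)"
    by (simp only:)
  \<comment> \<open>Both values are sums of the same series, which identifies the total contour
    integral with \<open>f z\<close>.\<close>
  then have "(\<Sum>j=1..N. I j) = f z"
    by (rule sums_unique2) (rule assms(9)[rule_format])
  moreover have "(\<lambda>s. \<Sum>j=1..N. (exp (z / a j / (1 + s)) - 1) * (F j (Ln (1 + s)) / (1 + s)))
      has_oint (\<Sum>j=1..N. I j)"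
    by (intro has_oint_sum) (use I in auto)
  ultimately show ?thesis
    by (simp only: divide_divide_eq_left)
qed

end
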